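(* Let $n\in\{1,2,3\}$, $c>0$, and let $f(x,t)=v(x+\eta t\hat a)$ be a positive traveling plane wave solution on $\mathbb{R}^n$ of $f_t=\Delta f+cf(1-f)$, with wave speed $\eta>0$ and wave direction $\hat a\in\mathbb{R}^n$, $|\hat a|=1$, where $v:\mathbb{R}^n\to\mathbb{R}$. Suppose that for some $\hat b\in\mathbb{R}^n$ with $|\hat b|\ne 0$, $$\lim_{k\to\infty}v(k\hat b)=0.$$ Then $$\eta\ge\begin{cases}\sqrt{(3-\sqrt3)\,c}, & n=1,\\ \sqrt{2c}, & n=2,\\ \sqrt{(7-3\sqrt3)\,c}, & n=3.\end{cases}$$
   Context: Solutions are understood to be $C^2$ in $x$ and $C^1$ in $t$. A traveling plane wave solution is one of the form $f(x,t)=v(x+\eta t\hat a)$ with $v:\mathbb{R}^n\to\mathbb{R}$, where $v$ is allowed to depend on all $n$ coordinates. *)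

theory Defs
  imports "HOL-Analysis.Analysis"
begin

definition partial_deriv :: "'n \<Rightarrow> (real ^ 'n \<Rightarrow> real) \<Rightarrow> real ^ 'n \<Rightarrow> real" where
  "partial_deriv i g x = deriv (\<lambda>h. g (x + h *\<^sub>R axis i 1)) 0"

text \<open>Since \<^const>\<open>deriv\<close> is total, existence of the partial derivatives is required separately.
  Continuity of the function itself follows from the continuity of its partial derivatives.\<close>

definition C1_fun :: "(real ^ 'n \<Rightarrow> real) \<Rightarrow> bool" where
  "C1_fun g \<longleftrightarrow>
     (\<forall>i. (\<forall>x. (\<lambda>h. g (x + h *\<^sub>R axis i 1)) differentiable (at 0)) \<and>
          continuous_on UNIV (partial_deriv i g))"

definition C2_fun :: "(real ^ 'n \<Rightarrow> real) \<Rightarrow> bool" where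
  "C2_fun g \<longleftrightarrow> C1_fun g \<and> (\<forall>i. C1_fun (partial_deriv i g))"

definition laplacian :: "(real ^ 'n \<Rightarrow> real) \<Rightarrow> real ^ 'n \<Rightarrow> real" where
  "laplacian g x = (\<Sum>i\<in>UNIV. partial_deriv i (partial_deriv i g) x)"

text \<open>Solutions live on the times \<open>t > 0\<close>. For a travelling wave this already determines the
  profile on the whole space, so it amounts to the same as requiring the equation for all real
  times.\<close>

definition fisher_solution :: "real \<Rightarrow> (real ^ 'n \<Rightarrow> real \<Rightarrow> real) \<Rightarrow> bool" where
  "fisher_solution c f \<longleftrightarrow>
     (\<forall>t>0. C2_fun (\<lambda>x. f x t)) \<and>
     (\<forall>x. f x C1_differentiable_on {0<..}) \<and>
     (\<forall>x. \<forall>t>0. deriv (f x) t = laplacian (\<lambda>y. f y t) x + c * f x t * (1 - f x t))"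

definition travelling_plane_wave ::
  "(real ^ 'n \<Rightarrow> real \<Rightarrow> real) \<Rightarrow> (real ^ 'n \<Rightarrow> real) \<Rightarrow> real \<Rightarrow> real ^ 'n \<Rightarrow> bool" where
  "travelling_plane_wave f v \<eta> a \<longleftrightarrow> (\<forall>x. \<forall>t>0. f x t = v (x + (\<eta> * t) *\<^sub>R a))"

end

theory Submission
  imports Defs
begin

text \<open>In the moving frame the profile solves \<open>\<eta> \<partial>\<^sub>a u = \<Delta>u + c u (1 - u)\<close>. If \<open>\<eta>\<^sup>2 < 4 c\<close>, then for small
  \<open>\<rho>\<close> and small \<open>m\<close> the function \<open>m \<Prod>\<^sub>i exp (\<eta> a\<^sub>i z\<^sub>i / 2) cos (\<rho> z\<^sub>i)\<close> is a strict subsolution on a cube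
  on whose boundary it vanishes. By the maximum principle it cannot touch a positive solution
  from below, so its central value \<open>m\<close> bounds \<open>u\<close> from below at every centre of translation. Hence
  a positive profile that is not bounded away from \<open>0\<close> has \<open>\<eta> \<ge> 2 sqrt c\<close>, which is more than
  what is claimed in each of the three dimensions.\<close>

section \<open>Calculus with partial derivatives and a second-order test\<close>

lemma C1_fun_has_partial_deriv:
  fixes u :: "real ^ 'n \<Rightarrow> real"
  assumes "C1_fun u"
  shows "((\<lambda>h. u (x + h *\<^sub>R axis i 1)) has_real_derivative partial_deriv i u (x + s *\<^sub>R axis i 1)) (at s)"
proof -
  have "(\<lambda>h. u ((x + s *\<^sub>R axis i 1) + h *\<^sub>R axis i 1)) differentiable (at 0)"
    using assms unfolding C1_fun_def by blast
  then have "(\<lambda>h. u ((x + s *\<^sub>R axis i 1) + h *\<^sub>R axis i 1)) field_differentiable (at 0)"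
    by (meson field_differentiable_def real_differentiableE)
  then have "((\<lambda>h. u ((x + s *\<^sub>R axis i 1) + h *\<^sub>R axis i 1)) has_real_derivative
      partial_deriv i u (x + s *\<^sub>R axis i 1)) (at 0)"
    unfolding partial_deriv_def by (simp add: DERIV_deriv_iff_field_differentiable)
  moreover have "(\<lambda>h. u ((x + s *\<^sub>R axis i 1) + h *\<^sub>R axis i 1)) = (\<lambda>h. u (x + (h + s) *\<^sub>R axis i 1))"
    by (simp add: algebra_simps)
  ultimately show ?thesis
    using DERIV_shift[of "\<lambda>h. u (x + h *\<^sub>R axis i 1)" _ 0 s] by simp
qed

text \<open>Near \<open>x\<close> the continuous partial derivatives are bounded. Moving one
  coordinate at a time, the mean value inequality bounds the change of \<open>u\<close> by a
  weighted sum of the coordinate increments, which tends to 0.\<close>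

lemma C1_fun_imp_continuous:
  fixes u :: "real ^ 'n \<Rightarrow> real"
  assumes C1: "C1_fun u"
  shows "continuous_on UNIV u"
proof -
  have "isCont u x" for x
  proof -
    have "\<exists>B>0. \<forall>y\<in>cball x 1. \<bar>partial_deriv i u y\<bar> \<le> B" for i
    proof -
      have "compact (partial_deriv i u ` cball x 1)"
        using C1 unfolding C1_fun_def
        by (meson compact_cball compact_continuous_image continuous_on_subset subset_UNIV)
      then show ?thesis
        using compact_imp_bounded bounded_pos by (metis image_eqI real_norm_def)
    qed
    then obtain B where B: "\<And>i. B i > 0" "\<And>i y. y \<in> cball x 1 \<Longrightarrow> \<bar>partial_deriv i u y\<bar> \<le> B i"
      by metis
    \<comment> \<open>\<open>P S h\<close> keeps the coordinates of \<open>h\<close> in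
      \<open>S\<close> and sets the others to 0, so induction on \<open>S\<close> leads from
      \<open>x\<close> to \<open>x + h\<close> along axis-parallel segments.\<close>
    define P where "P S h = (\<Sum>i\<in>S. (h $ i) *\<^sub>R axis i (1::real))" for S and h :: "real ^ 'n"
    have P_nth: "P S h $ j = (if j \<in> S then h $ j else 0)" for S h j
      unfolding P_def by (simp add: axis_def if_distrib cong: if_cong)
    have step: "\<bar>u (x + P S h) - u x\<bar> \<le> (\<Sum>i\<in>S. B i * \<bar>h $ i\<bar>)"
      if "norm h \<le> 1" for h S
    proof (use finite[of S] in \<open>induction S rule: finite_induct\<close>)
      case empty
      show ?case by (simp add: P_def)
    next
      case (insert i S)
      let ?g = "\<lambda>s. u ((x + P S h) + s *\<^sub>R axis i 1)"
      have "\<bar>?g (h $ i) - ?g 0\<bar> \<le> B i * \<bar>h $ i - 0\<bar>"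
        unfolding real_norm_def[symmetric]
      proof (rule field_differentiable_bound[where S = "closed_segment 0 (h $ i)"])
        fix s assume s: "s \<in> closed_segment 0 (h $ i)"
        show "(?g has_field_derivative partial_deriv i u ((x + P S h) + s *\<^sub>R axis i 1))
          (at s within closed_segment 0 (h $ i))"
          by (rule has_field_derivative_at_within[OF C1_fun_has_partial_deriv[OF C1]])
        have s': "\<bar>s\<bar> \<le> \<bar>h $ i\<bar>"
          using s by (auto simp: closed_segment_eq_real_ivl split: if_splits)
        \<comment> \<open>Each coordinate is dominated by that of \<open>h\<close>, so the segment
          stays in the unit ball where \<open>B i\<close> applies.\<close>
        have "norm (P S h + s *\<^sub>R axis i 1) \<le> norm h"
          by (rule norm_le_componentwise_cart)
            (use s' insert.hyps in \<open>auto simp: P_nth axis_def\<close>)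
        then show "norm (partial_deriv i u ((x + P S h) + s *\<^sub>R axis i 1)) \<le> B i"
          using B(2) \<open>norm h \<le> 1\<close> by (simp add: dist_norm add.assoc norm_minus_commute)
      qed auto
      moreover have "?g (h $ i) = u (x + P (insert i S) h)" "?g 0 = u (x + P S h)"
        using insert.hyps by (simp_all add: P_def algebra_simps)
      ultimately show ?case
        using insert by simp
    qed
    have P_UNIV: "P UNIV h = h" for h
      by (simp add: vec_eq_iff P_nth)
    have "((\<lambda>y. \<Sum>i\<in>UNIV. B i * \<bar>(y - x) $ i\<bar>) \<longlongrightarrow> (\<Sum>i\<in>UNIV. B i * \<bar>(x - x) $ i\<bar>)) (at x)"
      by (intro tendsto_intros)
    then have lim: "((\<lambda>y. \<Sum>i\<in>UNIV. B i * \<bar>(y - x) $ i\<bar>) \<longlongrightarrow> 0) (at x)"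
      by simp
    have "\<forall>\<^sub>F y in at x. norm (u y - u x) \<le> (\<Sum>i\<in>UNIV. B i * \<bar>(y - x) $ i\<bar>)"
      unfolding eventually_at
    proof (intro exI[of _ 1] conjI ballI impI)
      fix y assume "y \<noteq> x \<and> dist y x < 1"
      then show "norm (u y - u x) \<le> (\<Sum>i\<in>UNIV. B i * \<bar>(y - x) $ i\<bar>)"
        using step[of "y - x" UNIV] by (simp add: P_UNIV dist_norm)
    qed simp
    then have "((\<lambda>y. u y - u x) \<longlongrightarrow> 0) (at x)"
      using lim by (rule Lim_null_comparison)
    then show ?thesis
      unfolding isCont_def using LIM_zero_cancel by blast
  qed
  then show ?thesis
    by (simp add: continuous_at_imp_continuous_on)
qed

text \<open>Since \<open>w' 0 = 0\<close>, a negative \<open>d\<close> would make \<open>w'\<close>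
  negative just to the right of 0, and by the mean value theorem \<open>w\<close> would drop below
  \<open>w 0\<close> there.\<close>

lemma second_deriv_nonneg_at_local_min:
  fixes w w' :: "real \<Rightarrow> real"
  assumes w: "\<And>h. (w has_real_derivative w' h) (at h)"
    and w': "(w' has_real_derivative d) (at 0)"
    and "r > 0" and min: "\<And>h. \<bar>h\<bar> < r \<Longrightarrow> w 0 \<le> w h"
  shows "d \<ge> 0"
proof (rule ccontr)
  assume "\<not> d \<ge> 0"
  have "w' 0 = 0"
    by (rule DERIV_local_min[OF w \<open>r > 0\<close>]) (simp add: min)
  obtain e where e: "e > 0" "\<And>h. h > 0 \<Longrightarrow> h < e \<Longrightarrow> w' h < w' 0"
    using DERIV_neg_dec_right[OF w'] \<open>\<not> d \<ge> 0\<close> by auto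
  define h where "h = min e r / 2"
  have h: "0 < h" "h < e" "h < r"
    using \<open>e > 0\<close> \<open>r > 0\<close> by (auto simp: h_def)
  obtain z where "0 < z" "z < h" "w h - w 0 = (h - 0) * w' z"
    using MVT2[of 0 h w w'] h(1) w by blast
  moreover have "w' z < 0"
    using e(2)[of z] \<open>w' 0 = 0\<close> calculation h by simp
  ultimately have "w h - w 0 < 0"
    using h by (simp add: mult_pos_neg)
  then show False
    using min[of h] h by simp
qed

section \<open>Comparison with a subsolution on a cube\<close>

text \<open>The bound is uniform because the comparison function, its cube and the threshold
  \<open>m0\<close> are fixed before the centre \<open>y\<close> is chosen. The derivative along
  \<open>a\<close> is given by a witness, so its existence is part of the hypothesis.\<close>

lemma positive_subcritical_profile_bounded_below:
  fixes u :: "real ^ 'n \<Rightarrow> real" and a :: "real ^ 'n"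
  assumes C2: "C2_fun u" and pos: "\<And>x. u x > 0" and "norm a = 1" and "c > 0"
    and sub: "\<eta>\<^sup>2 < 4 * c"
    and eq: "\<And>x. \<exists>d. ((\<lambda>s. u (x + s *\<^sub>R a)) has_real_derivative d) (at 0) \<and>
                \<eta> * d = laplacian u x + c * u x * (1 - u x)"
  shows "\<exists>m>0. \<forall>x. u x \<ge> m"
proof -
  have C1: "C1_fun u" and C1': "\<And>i. C1_fun (partial_deriv i u)"
    using C2 unfolding C2_fun_def by auto
  have cont: "continuous_on UNIV u"
    by (rule C1_fun_imp_continuous[OF C1])
  define N where "N = real CARD('n)"
  have N: "N > 0" by (simp add: N_def)
  \<comment> \<open>The margin \<delta> is shared equally:
    \<open>N * \<rho>\<^sup>2 = \<delta> / 2\<close> pays for the curvature of the cosines, and the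
    other half for the quadratic term of the reaction.\<close>
  define \<delta> where "\<delta> = c - \<eta>\<^sup>2 / 4"
  have \<delta>: "\<delta> > 0" using sub by (simp add: \<delta>_def)
  define \<rho> where "\<rho> = sqrt (\<delta> / (2 * N))"
  have \<rho>: "\<rho> > 0" "N * \<rho>\<^sup>2 = \<delta> / 2"
    using \<delta> N by (auto simp: \<rho>_def)
  \<comment> \<open>The first positive zero of \<open>cos (\<rho> * s)\<close>, which makes the
    comparison function vanish on the faces of the cube.\<close>
  define L where "L = pi / (2 * \<rho>)"
  have L: "L > 0" using \<rho> by (simp add: L_def)
  define Q where "Q = {z :: real ^ 'n. \<forall>i. \<bar>z $ i\<bar> \<le> L}"
  have Q_cbox: "Q = cbox (\<chi> i. - L) (\<chi> i. L)"
    by (auto simp: Q_def mem_box_cart abs_le_iff minus_le_iff)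
  have Q: "compact Q" "0 \<in> Q"
    using L by (simp add: Q_cbox compact_cbox, simp add: Q_def)
  define g where "g i s = exp (\<eta> * a $ i * s / 2) * cos (\<rho> * s)" for i s
  define g' where
    "g' i s = exp (\<eta> * a $ i * s / 2) * (\<eta> * a $ i / 2 * cos (\<rho> * s) - \<rho> * sin (\<rho> * s))" for i s
  define g'' where
    "g'' i s = exp (\<eta> * a $ i * s / 2) * (((\<eta> * a $ i / 2)\<^sup>2 - \<rho>\<^sup>2) * cos (\<rho> * s)
                 - \<eta> * a $ i * \<rho> * sin (\<rho> * s))" for i s
  have g: "(g i has_real_derivative g' i s) (at s)" for i s
    unfolding g_def g'_def
    by (auto intro!: derivative_eq_intros simp: field_simps)
  have g': "(g' i has_real_derivative g'' i s) (at s)" for i s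
    unfolding g'_def g''_def
    by (auto intro!: derivative_eq_intros simp: field_simps power2_eq_square)
  \<comment> \<open>The exponent is half the drift coefficient, so the sine terms cancel and
    \<open>g i\<close> becomes an eigenfunction.\<close>
  have g_ode: "g'' i s - \<eta> * a $ i * g' i s = - (\<rho>\<^sup>2 + \<eta>\<^sup>2 * (a $ i)\<^sup>2 / 4) * g i s" for i s
    unfolding g_def g'_def g''_def by (simp add: field_simps power2_eq_square)
  define \<phi> where "\<phi> z = (\<Prod>i\<in>UNIV. g i (z $ i))" for z
  \<comment> \<open>The product without factor \<open>i\<close> is constant along axis
    \<open>i\<close>, so on such a line \<phi> is a multiple of \<open>g i\<close>.\<close>
  define R where "R i z = (\<Prod>j\<in>UNIV - {i}. g j (z $ j))" for i z
  have \<phi>_split: "\<phi> z = g i (z $ i) * R i z" for i z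
    unfolding \<phi>_def R_def by (simp add: prod.remove[of UNIV i])
  have \<phi>_line: "\<phi> (z + h *\<^sub>R axis i 1) = R i z * g i (z $ i + h)" for z h i
  proof -
    have "R i (z + h *\<^sub>R axis i 1) = R i z"
      unfolding R_def by (intro prod.cong) (auto simp: axis_def)
    then show ?thesis
      by (simp add: \<phi>_split[of _ i] axis_def)
  qed
  have \<phi>_dir: "((\<lambda>s. \<phi> (z + s *\<^sub>R a)) has_real_derivative (\<Sum>i\<in>UNIV. a $ i * g' i (z $ i) * R i z)) (at 0)"
    for z
  proof -
    have "((\<lambda>s. g i (z $ i + s * a $ i)) has_real_derivative (g' i (z $ i) * a $ i)) (at 0)" for i
    proof -
      have "((\<lambda>s. z $ i + s * a $ i) has_real_derivative a $ i) (at 0)"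
        by (auto intro!: derivative_eq_intros)
      moreover have "(g i has_real_derivative g' i (z $ i)) (at (z $ i + 0 * a $ i))"
        using g by simp
      ultimately show ?thesis
        by (rule DERIV_chain2[rotated])
    qed
    then have "((\<lambda>s. \<Prod>i\<in>UNIV. g i (z $ i + s * a $ i)) has_real_derivative
        (\<Sum>i\<in>UNIV. g' i (z $ i) * a $ i * (\<Prod>j\<in>UNIV - {i}. g j (z $ j + 0 * a $ j)))) (at 0)"
      by (rule has_field_derivative_prod)
    then show ?thesis
      by (simp add: \<phi>_def R_def mult.commute)
  qed
  have \<phi>_cont: "continuous_on UNIV \<phi>"
    unfolding \<phi>_def g_def by (intro continuous_intros) auto
  have "bounded (\<phi> ` Q)"
    by (meson Q(1) \<phi>_cont compact_continuous_image compact_imp_bounded continuous_on_subset subset_UNIV)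
  then obtain K where K: "K > 0" "\<And>z. z \<in> Q \<Longrightarrow> \<bar>\<phi> z\<bar> \<le> K"
    unfolding bounded_pos by auto
  have \<phi>0: "\<phi> 0 = 1"
    by (simp add: \<phi>_def g_def)
  \<comment> \<open>Chosen so that \<open>c * m * \<phi> z < \<delta> / 2\<close> on the cube
    whenever \<open>0 < m < m0\<close>.\<close>
  define m0 where "m0 = \<delta> / (2 * c * K)"
  have m0: "m0 > 0" using \<delta> K \<open>c > 0\<close> by (simp add: m0_def)
  have "u y \<ge> m0" for y
  proof (rule ccontr)
    assume less: "\<not> u y \<ge> m0"
    \<comment> \<open>This quotient is maximised instead of minimising its reciprocal, since \<phi>
      has zeros on \<open>Q\<close> while \<open>u\<close> has none.\<close>
    have "continuous_on Q (\<lambda>z. \<phi> z / u (y + z))"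
    proof (intro continuous_intros)
      show "continuous_on Q \<phi>"
        using \<phi>_cont continuous_on_subset by blast
      show "continuous_on Q (\<lambda>z. u (y + z))"
        by (rule continuous_on_compose2[OF cont]) (auto intro!: continuous_intros)
      show "\<forall>z\<in>Q. u (y + z) \<noteq> 0"
        using pos by (metis less_irrefl)
    qed
    then obtain z where z: "z \<in> Q" and
      max: "\<And>z'. z' \<in> Q \<Longrightarrow> \<phi> z' / u (y + z') \<le> \<phi> z / u (y + z)"
      using continuous_attains_sup[OF Q(1)] Q(2) by blast
    have "1 / u y \<le> \<phi> z / u (y + z)"
      using max[OF Q(2)] \<phi>0 by simp
    moreover have "1 / m0 < 1 / u y"
      using less m0 pos[of y] by (simp add: frac_less2)
    ultimately have lt: "1 / m0 < \<phi> z / u (y + z)"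
      by linarith
    then have "\<phi> z / u (y + z) > 0"
      using m0 by (meson less_trans zero_less_divide_1_iff)
    then have \<phi>z: "\<phi> z > 0"
      using pos[of "y + z"] by (simp add: zero_less_divide_iff)
    \<comment> \<open>The reciprocal of the maximum is the largest multiple of \<phi> that fits
      below \<open>u\<close> on the cube, with contact at \<open>z\<close>. Comparing with the
      centre gives \<open>m < m0\<close>.\<close>
    define m where "m = u (y + z) / \<phi> z"
    have m: "m > 0" "m < m0" "m * \<phi> z = u (y + z)"
      using lt m0 pos[of "y + z"] \<phi>z by (auto simp: m_def field_simps)
    have above: "m * \<phi> z' \<le> u (y + z')" if "z' \<in> Q" for z'
      using max[OF that] pos[of "y + z'"] pos[of "y + z"] \<phi>z
      by (simp add: m_def field_simps)
    \<comment> \<open>On a face one cosine factor is 0, against \<open>\<phi> z > 0\<close>.\<close>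
    have interior: "\<bar>z $ i\<bar> < L" for i
    proof (rule ccontr)
      assume "\<not> \<bar>z $ i\<bar> < L"
      then have "\<bar>z $ i\<bar> = L"
        using z by (auto simp: Q_def not_less intro: order.antisym)
      then have "z $ i = L \<or> z $ i = - L"
        by linarith
      moreover have "\<rho> * L = pi / 2"
        using \<rho>(1) by (simp add: L_def)
      ultimately have "\<rho> * z $ i = pi / 2 \<or> \<rho> * z $ i = - (pi / 2)"
        by (elim disjE) simp_all
      then have "cos (\<rho> * z $ i) = 0"
        by (elim disjE) (simp_all only: cos_minus cos_pi_half)
      then show False
        using \<phi>z \<phi>_split[of z i] by (simp add: g_def)
    qed
    have "open {z :: real ^ 'n. \<forall>i. \<bar>z $ i\<bar> < L}"
    proof -
      have "{z :: real ^ 'n. \<forall>i. \<bar>z $ i\<bar> < L} = box (\<chi> i. - L) (\<chi> i. L)"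
        by (auto simp: mem_box_cart abs_less_iff minus_less_iff)
      then show ?thesis by (simp add: open_box)
    qed
    then obtain r where r: "r > 0" "ball z r \<subseteq> {z. \<forall>i. \<bar>z $ i\<bar> < L}"
      by (rule openE[where x = z]) (use interior in auto)
    have near: "m * \<phi> (z + h *\<^sub>R e) \<le> u (y + z + h *\<^sub>R e)" if "norm e = 1" "\<bar>h\<bar> < r" for h e
    proof -
      have "z + h *\<^sub>R e \<in> ball z r"
        using that by (simp add: dist_norm)
      then have "z + h *\<^sub>R e \<in> Q"
        using r(2) by (force simp: Q_def intro: less_imp_le)
      then show ?thesis
        using above by (simp add: add.assoc)
    qed
    \<comment> \<open>Second-order condition along axis \<open>i\<close> for the difference
      \<open>u - m \<phi>\<close>, which has an interior minimum at the contact point.\<close>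
    have second: "m * (R i z * g'' i (z $ i)) \<le> partial_deriv i (partial_deriv i u) (y + z)" for i
    proof -
      have shift: "((\<lambda>h. k (z $ i + h)) has_real_derivative k' (z $ i + s)) (at s)"
        if "\<And>s. (k has_real_derivative k' s) (at s)" for k k' :: "real \<Rightarrow> real" and s
        using that[of "z $ i + s"] DERIV_shift[of k _ s "z $ i"] by (simp add: add.commute)
      have "0 \<le> partial_deriv i (partial_deriv i u) (y + z) - m * (R i z * g'' i (z $ i))"
      proof (rule second_deriv_nonneg_at_local_min[OF _ _ r(1)])
        show "((\<lambda>h. u (y + z + h *\<^sub>R axis i 1) - m * (R i z * g i (z $ i + h))) has_real_derivative
            partial_deriv i u (y + z + h *\<^sub>R axis i 1) - m * (R i z * g' i (z $ i + h))) (at h)" for h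
          by (intro DERIV_diff DERIV_cmult C1_fun_has_partial_deriv C1 shift g)
        have "((\<lambda>h. partial_deriv i u (y + z + h *\<^sub>R axis i 1) - m * (R i z * g' i (z $ i + h)))
            has_real_derivative partial_deriv i (partial_deriv i u) (y + z + 0 *\<^sub>R axis i 1)
              - m * (R i z * g'' i (z $ i + 0))) (at 0)"
          by (intro DERIV_diff DERIV_cmult C1_fun_has_partial_deriv C1' shift g')
        then show "((\<lambda>h. partial_deriv i u (y + z + h *\<^sub>R axis i 1) - m * (R i z * g' i (z $ i + h)))
            has_real_derivative partial_deriv i (partial_deriv i u) (y + z)
              - m * (R i z * g'' i (z $ i))) (at 0)"
          by simp
        show "u (y + z + 0 *\<^sub>R axis i 1) - m * (R i z * g i (z $ i + 0))
            \<le> u (y + z + h *\<^sub>R axis i 1) - m * (R i z * g i (z $ i + h))" if "\<bar>h\<bar> < r" for h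
          using near[of "axis i 1" h] that m(3) \<phi>_line[of z h i] \<phi>_line[of z 0 i]
          by simp
      qed
      then show ?thesis by simp
    qed
    obtain d where d: "((\<lambda>s. u (y + z + s *\<^sub>R a)) has_real_derivative d) (at 0)"
      and pde: "\<eta> * d = laplacian u (y + z) + c * u (y + z) * (1 - u (y + z))"
      using eq by blast
    define D where "D = (\<Sum>i\<in>UNIV. a $ i * g' i (z $ i) * R i z)"
    have "((\<lambda>s. u (y + z + s *\<^sub>R a) - m * \<phi> (z + s *\<^sub>R a)) has_real_derivative d - m * D) (at 0)"
      unfolding D_def by (intro DERIV_diff DERIV_cmult \<phi>_dir d)
    \<comment> \<open>First-order condition at the same minimum, now along \<open>a\<close>: the
      drift terms of \<open>u\<close> and \<open>m \<phi>\<close> agree.\<close>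
    then have "d - m * D = 0"
      by (rule DERIV_local_min[OF _ r(1)]) (use near \<open>norm a = 1\<close> m(3) in auto)
    then have "\<eta> * (m * D) = laplacian u (y + z) + c * u (y + z) * (1 - u (y + z))"
      using pde by simp
    moreover have "(\<Sum>i\<in>UNIV. m * (R i z * g'' i (z $ i))) \<le> laplacian u (y + z)"
      unfolding laplacian_def by (intro sum_mono second)
    moreover have "(\<Sum>i\<in>UNIV. m * (R i z * g'' i (z $ i))) - \<eta> * (m * D) = - (\<delta> / 2 + \<eta>\<^sup>2 / 4) * u (y + z)"
    proof -
      have "(\<Sum>i\<in>UNIV. m * (R i z * g'' i (z $ i))) - \<eta> * (m * D)
          = (\<Sum>i\<in>UNIV. m * R i z * (g'' i (z $ i) - \<eta> * a $ i * g' i (z $ i)))"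
        unfolding D_def by (simp add: sum_distrib_left sum_subtractf algebra_simps)
      also have "\<dots> = (\<Sum>i\<in>UNIV. - (\<rho>\<^sup>2 + \<eta>\<^sup>2 / 4 * (a $ i)\<^sup>2) * u (y + z))"
      proof (intro sum.cong refl)
        fix i
        have "u (y + z) = m * (g i (z $ i) * R i z)"
          using m(3) \<phi>_split by metis
        then show "m * R i z * (g'' i (z $ i) - \<eta> * a $ i * g' i (z $ i))
            = - (\<rho>\<^sup>2 + \<eta>\<^sup>2 / 4 * (a $ i)\<^sup>2) * u (y + z)"
          unfolding g_ode by (simp add: algebra_simps)
      qed
      also have "\<dots> = - (N * \<rho>\<^sup>2 + \<eta>\<^sup>2 / 4 * (\<Sum>i\<in>UNIV. (a $ i)\<^sup>2)) * u (y + z)"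
        by (simp only: sum_distrib_right[symmetric] sum_negf sum.distrib)
          (simp add: N_def sum_distrib_left[symmetric] sum_divide_distrib[symmetric])
      also have "(\<Sum>i\<in>UNIV. (a $ i)\<^sup>2) = 1"
        using \<open>norm a = 1\<close> by (simp add: norm_vec_def L2_set_def)
      finally show ?thesis
        by (simp add: \<rho>(2))
    qed
    \<comment> \<open>Dividing by the positive value of \<open>u\<close> leaves
      \<open>\<delta> / 2 \<le> c * u (y + z)\<close>, which the choice of \<open>m0\<close>
      excludes.\<close>
    ultimately have "(c - \<delta> / 2 - \<eta>\<^sup>2 / 4 - c * u (y + z)) * u (y + z) \<le> 0"
      by (simp add: algebra_simps)
    then have "c - \<delta> / 2 - \<eta>\<^sup>2 / 4 \<le> c * u (y + z)"
      using pos[of "y + z"] by (simp add: mult_le_0_iff)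
    then have "\<delta> / 2 \<le> c * u (y + z)"
      unfolding \<delta>_def by argo
    moreover have "u (y + z) < m0 * K"
    proof -
      have "m * \<phi> z < m0 * \<phi> z"
        using m(2) \<phi>z by simp
      also have "\<dots> \<le> m0 * K"
        using K(2)[OF z] m0 by simp
      finally show ?thesis using m(3) by simp
    qed
    then have "c * u (y + z) < c * (m0 * K)"
      using \<open>c > 0\<close> by simp
    moreover have "c * (m0 * K) = \<delta> / 2"
      using \<open>c > 0\<close> K(1) by (simp add: m0_def)
    ultimately show False by linarith
  qed
  then show ?thesis using m0 by blast
qed

section \<open>From profiles to wave speeds\<close>

lemma travelling_wave_speed_ge:
  fixes f :: "real ^ 'n \<Rightarrow> real \<Rightarrow> real"
  assumes "c > 0" and sol: "fisher_solution c f" and pos: "\<And>x t. t > 0 \<Longrightarrow> f x t > 0"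
    and wave: "travelling_plane_wave f v \<eta> a"
    and "\<eta> > 0" and "norm a = 1" and lim: "(\<lambda>k. v (p k)) \<longlonglongrightarrow> 0"
  shows "\<eta> \<ge> 2 * sqrt c"
proof (rule ccontr)
  assume "\<not> \<eta> \<ge> 2 * sqrt c"
  then have "\<eta>\<^sup>2 < (2 * sqrt c)\<^sup>2"
    using \<open>\<eta> > 0\<close> by (intro power_strict_mono) auto
  then have sub: "\<eta>\<^sup>2 < 4 * c"
    using \<open>c > 0\<close> by (simp add: power_mult_distrib)
  \<comment> \<open>The slice at time 1 lies inside the time domain and is a translate of
    \<open>v\<close>, so a lower bound for \<open>u\<close> holds for all of
    \<open>v\<close>.\<close>
  define u where "u x = f x 1" for x
  have u: "u x = v (x + \<eta> *\<^sub>R a)" for x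
    using wave by (simp add: u_def travelling_plane_wave_def)
  have "\<exists>d. ((\<lambda>s. u (x + s *\<^sub>R a)) has_real_derivative d) (at 0) \<and>
          \<eta> * d = laplacian u x + c * u x * (1 - u x)" for x
  proof -
    have "f x C1_differentiable_on {0<..}"
      using sol by (simp add: fisher_solution_def)
    then have "f x differentiable (at 1)"
      by (simp add: C1_differentiable_on_eq)
    then have "f x field_differentiable (at 1)"
      by (meson field_differentiable_def real_differentiableE)
    then have "(f x has_real_derivative deriv (f x) 1) (at 1)"
      by (simp add: DERIV_deriv_iff_field_differentiable)
    \<comment> \<open>Waiting for time \<open>s / \<eta>\<close> moves the profile by
      \<open>s\<close> along \<open>a\<close>, which turns the time derivative into \<eta> times the
      derivative along \<open>a\<close>.\<close>
    moreover have "((\<lambda>s. 1 + s / \<eta>) has_real_derivative 1 / \<eta>) (at 0)"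
      using \<open>\<eta> > 0\<close> by (auto intro!: derivative_eq_intros)
    ultimately have "((\<lambda>s. f x (1 + s / \<eta>)) has_real_derivative deriv (f x) 1 * (1 / \<eta>)) (at 0)"
      by (intro DERIV_chain2[of "f x" _ "\<lambda>s. 1 + s / \<eta>" 0]) auto
    moreover have "\<forall>\<^sub>F s in nhds 0. f x (1 + s / \<eta>) = u (x + s *\<^sub>R a)"
    proof -
      \<comment> \<open>Exactly for these \<open>s\<close> the time \<open>1 + s / \<eta>\<close> is
        positive, as the wave form requires.\<close>
      have "\<forall>\<^sub>F s in nhds 0. s \<in> {- \<eta><..}"
        using \<open>\<eta> > 0\<close> by (intro eventually_nhds_in_open) auto
      then show ?thesis
      proof (rule eventually_mono)
        fix s assume "s \<in> {- \<eta><..}"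
        then have "1 + s / \<eta> > 0"
          using \<open>\<eta> > 0\<close> by (simp add: field_simps)
        then have "f x (1 + s / \<eta>) = v (x + (\<eta> * (1 + s / \<eta>)) *\<^sub>R a)"
          using wave by (simp add: travelling_plane_wave_def)
        also have "\<eta> * (1 + s / \<eta>) = \<eta> + s"
          using \<open>\<eta> > 0\<close> by (simp add: field_simps)
        finally show "f x (1 + s / \<eta>) = u (x + s *\<^sub>R a)"
          by (simp add: u algebra_simps)
      qed
    qed
    ultimately have "((\<lambda>s. u (x + s *\<^sub>R a)) has_real_derivative deriv (f x) 1 * (1 / \<eta>)) (at 0)"
      by (simp only: DERIV_cong_ev[OF refl _ refl])
    moreover have "\<eta> * (deriv (f x) 1 * (1 / \<eta>)) = laplacian u x + c * u x * (1 - u x)"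
      using sol \<open>\<eta> > 0\<close> unfolding fisher_solution_def u_def by simp
    ultimately show ?thesis by blast
  qed
  moreover have "C2_fun u"
    using sol unfolding fisher_solution_def u_def by simp
  moreover have "u x > 0" for x
    using pos by (simp add: u_def)
  ultimately have "\<exists>m>0. \<forall>x. u x \<ge> m"
    using \<open>norm a = 1\<close> \<open>c > 0\<close> sub by (intro positive_subcritical_profile_bounded_below[of u a c \<eta>])
  then obtain m where "m > 0" and m: "\<And>x. u x \<ge> m"
    by blast
  have "m \<le> v y" for y
    using m[of "y - \<eta> *\<^sub>R a"] by (simp add: u)
  then have "m \<le> 0"
    by (intro LIMSEQ_le_const[OF lim]) simp
  then show False using \<open>m > 0\<close> by simp
qed

theorem theorem3:
  fixes f :: "real ^ 'n \<Rightarrow> real \<Rightarrow> real"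
    and v :: "real ^ 'n \<Rightarrow> real"
    and c \<eta> :: real
    and a b :: "real ^ 'n"
  assumes "CARD('n) \<in> {1, 2, 3}"
    and "c > 0"
    and "fisher_solution c f"
    and "\<forall>x. \<forall>t>0. f x t > 0"
    and "travelling_plane_wave f v \<eta> a"
    and "\<eta> > 0"
    and "norm a = 1"
    and "norm b \<noteq> 0"
    and "(\<lambda>k::nat. v (real k *\<^sub>R b)) \<longlonglongrightarrow> 0"
  shows "\<eta> \<ge> (if CARD('n) = 1 then sqrt ((3 - sqrt 3) * c)
              else if CARD('n) = 2 then sqrt (2 * c)
              else sqrt ((7 - 3 * sqrt 3) * c))"
proof -
  have "\<eta> \<ge> 2 * sqrt c"
    by (rule travelling_wave_speed_ge[of c f v \<eta> a "\<lambda>k. real k *\<^sub>R b"]) (use assms in auto)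
  \<comment> \<open>All three constants under the roots are at most 4; for
    \<open>7 - 3 * sqrt 3\<close> this amounts to \<open>1 \<le> sqrt 3\<close>.\<close>
  moreover have "sqrt (k * c) \<le> 2 * sqrt c" if "k \<le> 4" for k
  proof -
    have "sqrt (k * c) \<le> sqrt (4 * c)"
      using that \<open>c > 0\<close> by simp
    then show ?thesis
      by (simp add: real_sqrt_mult)
  qed
  moreover have "1 \<le> sqrt 3"
    by simp
  ultimately have "\<eta> \<ge> sqrt (k * c)" if "k \<le> 4" for k
    using that by (meson order.trans)
  from this[of "3 - sqrt 3"] this[of 2] this[of "7 - 3 * sqrt 3"] \<open>1 \<le> sqrt 3\<close> show ?thesis
    by simp
qed

end
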